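(* Let $\mathcal H$ be a real Hilbert space and let $f,g\in\Gamma_0(\mathcal H)$ be such that $\operatorname{lev}_{\leq 0}f\neq\varnothing$ and $\operatorname{lev}_{\leq 0}g\neq\varnothing$. Let $h=f\,\square\,g$ be their infimal convolution and suppose that $h\in\Gamma_0(\mathcal H)$ and that the infimum defining $h(x)$ is attained for every $x\in\mathcal H$. Let $M:\mathcal H\to\mathcal H$ be such that, for every $x\in\mathcal H$, $Mx$ minimizes $y\mapsto f(y)+g(x-y)$, so that $h(x)=f(Mx)+g(x-Mx)$. Suppose that $\operatorname{lev}_{\leq 0}(f\circ M)\cap\operatorname{lev}_{\leq 0}(g\circ(\operatorname{Id}-M))\neq\varnothing$ and that there exists $x$ with $\partial f(x)\cap\partial g(x)\neq\varnothing$. Suppose that $U$ is a selection of $x\mapsto\partial f(x)\cap\partial g(x)$ such that $\operatorname{im}M\cup\operatorname{im}(\operatorname{Id}-M)\subset\operatorname{dom}U$ and $Ux=U(Mx)=U(x-Mx)$ for every $x\in\operatorname{dom}U$. Then: (i) $G_h^U$ is well defined, i.e. $\operatorname{lev}_{\leq 0}h\neq\varnothing$ and $U$ is a selection of $\partial h$. (ii) $\big(\operatorname{lev}_{\leq 0}(f\circ M)\cap\operatorname{lev}_{\leq 0}(g\circ(\operatorname{Id}-M))\big)\cup\operatorname{dom}U\subset\operatorname{dom}(G_f^U\circ M)\cap\operatorname{dom}(G_g^U\circ(\operatorname{Id}-M))\cap\operatorname{dom}G_h^U$. (iii) For every $x\in\big(\operatorname{lev}_{\leq 0}(f\circ M)\cap\operatorname{lev}_{\leq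 0}(g\circ(\operatorname{Id}-M))\big)\cup\operatorname{dom}U$, $$G_h^Ux=G_f^U(Mx)+G_g^U(x-Mx)\iff f(Mx)\,g(x-Mx)\geq 0 .$$
   Context: $\Gamma_0(\mathcal H)$ is the set of proper convex lower semicontinuous functions $\mathcal H\to]-\infty,+\infty]$; for any $\varphi:\mathcal H\to[-\infty,+\infty]$, $\operatorname{lev}_{\leq 0}\varphi=\{x: \varphi(x)\leq 0\}$. The infimal convolution is $(f\,\square\,g)(x)=\inf_{y\in\mathcal H}(f(y)+g(x-y))$. $\partial f$ is the convex subdifferential. A selection of a set-valued operator $A:\mathcal H\to2^{\mathcal H}$ is a map $U$ defined on some subset $\operatorname{dom}U\subset\{x:Ax\neq\varnothing\}$ with $Ux\in Ax$ for all $x\in\operatorname{dom}U$. For $f\in\Gamma_0(\mathcal H)$ with $\operatorname{lev}_{\leq 0}f\neq\varnothing$ and a selection $U$ of $\partial f$, $G_f^U$ is the single-valued map with domain $\operatorname{lev}_{\leq 0}f\cup\operatorname{dom}U$ given by $G_f^Ux=x$ if $f(x)\leq0$ and $G_f^Ux=x-\frac{f(x)}{\|Ux\|^2}Ux$ if $f(x)>0$ and $x\in\operatorname{dom}U$ (subgradients at points where $f>0$ are nonzero because $\operatorname{lev}_{\leq 0}f\neq\varnothing$). The domain of a composition $G\circ M$ is $\{x: Mx\in\operatorname{dom}G\}$. *)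

theory Defs
  imports "HOL-Analysis.Analysis"
begin

definition proper_fun :: "('a \<Rightarrow> ereal) \<Rightarrow> bool" where
  "proper_fun f \<longleftrightarrow> (\<forall>x. f x \<noteq> - \<infinity>) \<and> (\<exists>x. f x \<noteq> \<infinity>)"

text \<open>The weights are strictly positive and this notion is only used for functions that avoid
  \<open>-\<infinity>\<close>, so the indeterminate forms \<open>0 * \<infinity>\<close> and \<open>\<infinity> - \<infinity>\<close> do not arise.\<close>

definition convex_fun :: "('a::real_vector \<Rightarrow> ereal) \<Rightarrow> bool" where
  "convex_fun f \<longleftrightarrow> (\<forall>x y. \<forall>s>0. \<forall>t>0. s + t = 1 \<longrightarrow>
     f (s *\<^sub>R x + t *\<^sub>R y) \<le> ereal s * f x + ereal t * f y)"

definition lsc_fun :: "('a::topological_space \<Rightarrow> ereal) \<Rightarrow> bool" where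
  "lsc_fun f \<longleftrightarrow> (\<forall>x. f x \<le> Liminf (at x) f)"

definition Gamma0 :: "('a::real_inner \<Rightarrow> ereal) set" where
  "Gamma0 = {f. proper_fun f \<and> convex_fun f \<and> lsc_fun f}"

definition lev0 :: "('a \<Rightarrow> ereal) \<Rightarrow> 'a set" where
  "lev0 \<phi> = {x. \<phi> x \<le> 0}"

definition inf_conv :: "('a::real_vector \<Rightarrow> ereal) \<Rightarrow> ('a \<Rightarrow> ereal) \<Rightarrow> 'a \<Rightarrow> ereal" where
  "inf_conv f g x = (INF y. f y + g (x - y))"

definition subdifferential :: "('a::real_inner \<Rightarrow> ereal) \<Rightarrow> 'a \<Rightarrow> 'a set" where
  "subdifferential f x = {u. \<forall>y. ereal (inner (y - x) u) + f x \<le> f y}"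

text \<open>Single-valued operators defined on a subset of the space are maps into the option type, with
  \<open>dom\<close> as their domain. For total \<open>M\<close>, the domain of the ordinary composition \<open>G \<circ> M\<close>
  is then \<open>{x. M x \<in> dom G}\<close>.\<close>

definition is_selection :: "('a \<Rightarrow> 'b set) \<Rightarrow> ('a \<rightharpoonup> 'b) \<Rightarrow> bool" where
  "is_selection A U \<longleftrightarrow> (\<forall>x\<in>dom U. the (U x) \<in> A x)"

text \<open>When \<open>U\<close> is a selection of the subdifferential of a proper function \<open>f\<close>, the value \<open>f x\<close> is
  finite on \<open>dom U\<close>, so \<open>real_of_ereal\<close> loses nothing.\<close>

definition subgrad_proj :: "('a::real_inner \<Rightarrow> ereal) \<Rightarrow> ('a \<rightharpoonup> 'a) \<Rightarrow> ('a \<rightharpoonup> 'a)" where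
  "subgrad_proj f U x =
     (if f x \<le> 0 then Some x
      else map_option (\<lambda>u. x - (real_of_ereal (f x) / (norm u)\<^sup>2) *\<^sub>R u) (U x))"

lemma dom_subgrad_proj: "dom (subgrad_proj f U) = lev0 f \<union> dom U"
  by (auto simp: subgrad_proj_def lev0_def dom_def split: if_splits)

end

(* The infimum being attained at M x, the Fenchel inequalities at M x and x - M x add up to show that
   the common subgradient u = U x of f at M x and of g at x - M x is a subgradient of h at x. Thus,
   with a = f (M x) and b = g (x - M x), the three projectors subtract the multiples max a 0,
   max b 0 and max (a + b) 0 of the same vector u / |u|^2, and additivity of the positive part
   amounts to a * b >= 0. If u = 0, then a and b are minimal values, hence nonpositive. *)

theory Submission
  imports Defs
begin

lemma is_arg_min_inf_conv:
  assumes "is_arg_min (\<lambda>y. f y + g (x - y)) (\<lambda>_. True) p"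
  shows "inf_conv f g x = f p + g (x - p)"
  unfolding inf_conv_def
  using assms by (intro antisym INF_lower INF_greatest) (auto simp: is_arg_min_linorder)

text \<open>The subgradient inequality, tested at a point where \<open>f\<close> is not \<infinity>,
  bounds \<open>f x\<close> from above; properness excludes -\<infinity>.\<close>

lemma subdifferential_finite:
  assumes "proper_fun f" "u \<in> subdifferential f x"
  shows "\<bar>f x\<bar> \<noteq> \<infinity>"
proof -
  obtain y where "f y \<noteq> \<infinity>"
    using assms(1) by (auto simp: proper_fun_def)
  moreover have "ereal (inner (y - x) u) + f x \<le> f y"
    using assms(2) by (auto simp: subdifferential_def)
  ultimately have "f x \<noteq> \<infinity>"
    by auto
  then show ?thesis
    using assms(1) by (auto simp: proper_fun_def)
qed

text \<open>A zero subgradient makes \<open>x\<close> a global minimizer, so \<open>f x\<close> is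
  at most the value at any point of \<open>lev0 f\<close>. This settles the degenerate case of a
  zero denominator.\<close>

lemma zero_subgradient_nonpos:
  assumes "0 \<in> subdifferential f x" "lev0 f \<noteq> {}"
  shows "f x \<le> 0"
  using assms by (force simp: subdifferential_def lev0_def intro: order_trans)

lemma subdifferential_inf_conv:
  assumes x: "inf_conv f g x = f p + g (x - p)"
    and f: "u \<in> subdifferential f p" and g: "u \<in> subdifferential g (x - p)"
    and fin: "\<bar>f p\<bar> \<noteq> \<infinity>" "\<bar>g (x - p)\<bar> \<noteq> \<infinity>"
  shows "u \<in> subdifferential (inf_conv f g) x"
proof -
  obtain a b where ab: "f p = ereal a" "g (x - p) = ereal b"
    using fin by auto
  have "ereal (inner (y - x) u) + (f p + g (x - p)) \<le> f z + g (y - z)" for y z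
  proof -
    have "ereal (inner (z - p) u) + f p \<le> f z"
      using f by (simp add: subdifferential_def)
    moreover have "ereal (inner ((y - z) - (x - p)) u) + g (x - p) \<le> g (y - z)"
      using g unfolding subdifferential_def by blast
    ultimately have "ereal (inner (z - p) u) + f p
        + (ereal (inner ((y - z) - (x - p)) u) + g (x - p)) \<le> f z + g (y - z)"
      by (rule add_mono)
    \<comment> \<open>The displacements \<open>z - p\<close> and \<open>(y - z) - (x - p)\<close>
      sum to \<open>y - x\<close>, so the lower bound does not depend on \<open>z\<close> and passes
      to the infimum. Finiteness of both values permits the rearrangement in
      \<open>ereal\<close>.\<close>
    then show ?thesis
      by (simp add: ab inner_diff_left algebra_simps)
  qed
  then have "ereal (inner (y - x) u) + (f p + g (x - p)) \<le> inf_conv f g y" for y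
    unfolding inf_conv_def by (rule INF_greatest)
  then show ?thesis
    by (simp add: subdifferential_def x)
qed

text \<open>The positive part merges both branches of the projector into one formula. It also covers
  \<open>u = 0\<close>, where the correction vanishes.\<close>

lemma subgrad_proj_eq_max:
  assumes "f x = ereal a" "U x = Some u"
  shows "subgrad_proj f U x = Some (x - (max a 0 / (norm u)\<^sup>2) *\<^sub>R u)"
  using assms by (auto simp: subgrad_proj_def max_def)

text \<open>The positive part is subadditive, and the inequality is strict exactly when the two
  numbers have strictly opposite signs.\<close>

lemma max_0_add_iff:
  fixes a b :: real
  shows "max (a + b) 0 = max a 0 + max b 0 \<longleftrightarrow> 0 \<le> a * b"
  by (auto simp: max_def zero_le_mult_iff)

theorem proposition2p23:
  fixes f g h :: "'a::{real_inner, complete_space} \<Rightarrow> ereal"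
    and M :: "'a \<Rightarrow> 'a"
    and U :: "'a \<rightharpoonup> 'a"
  assumes f: "f \<in> Gamma0" and g: "g \<in> Gamma0"
    and lev_f: "lev0 f \<noteq> {}" and lev_g: "lev0 g \<noteq> {}"
    and h_def: "h = inf_conv f g"
    and h: "h \<in> Gamma0"
    and attained: "\<forall>x. \<exists>y. h x = f y + g (x - y)"
    and M: "\<forall>x. is_arg_min (\<lambda>y. f y + g (x - y)) (\<lambda>_. True) (M x)"
    and lev_M: "lev0 (f \<circ> M) \<inter> lev0 (g \<circ> (\<lambda>x. x - M x)) \<noteq> {}"
    and common_subgradient: "\<exists>x. subdifferential f x \<inter> subdifferential g x \<noteq> {}"
    and U: "is_selection (\<lambda>x. subdifferential f x \<inter> subdifferential g x) U"
    and im_M: "range M \<union> range (\<lambda>x. x - M x) \<subseteq> dom U"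
    and U_M: "\<forall>x\<in>dom U. U x = U (M x) \<and> U x = U (x - M x)"
  shows "(lev0 h \<noteq> {} \<and> is_selection (subdifferential h) U)
    \<and> (lev0 (f \<circ> M) \<inter> lev0 (g \<circ> (\<lambda>x. x - M x))) \<union> dom U
        \<subseteq> dom (subgrad_proj f U \<circ> M) \<inter> dom (subgrad_proj g U \<circ> (\<lambda>x. x - M x))
          \<inter> dom (subgrad_proj h U)
    \<and> (\<forall>x \<in> (lev0 (f \<circ> M) \<inter> lev0 (g \<circ> (\<lambda>x. x - M x))) \<union> dom U.
        the (subgrad_proj h U x) = the (subgrad_proj f U (M x)) + the (subgrad_proj g U (x - M x))
          \<longleftrightarrow> f (M x) * g (x - M x) \<ge> 0)"
proof -
  have U_M': "U x = U (M x)" "U x = U (x - M x)" if "x \<in> dom U" for x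
    using U_M that by blast+
  have sub: "u \<in> subdifferential f x" "u \<in> subdifferential g x" if "U x = Some u" for x u
    using U that by (force simp: is_selection_def)+
  have dom_U: "M x \<in> dom U" "x - M x \<in> dom U" for x
    using im_M by blast+
  have proper: "proper_fun f" "proper_fun g"
    using f g by (auto simp: Gamma0_def)
  \<comment> \<open>Even for \<open>x\<close> outside \<open>dom U\<close>, the points
    \<open>M x\<close> and \<open>x - M x\<close> lie in \<open>dom U\<close> and so carry
    subgradients of \<open>f\<close> and \<open>g\<close>.\<close>
  have fin: "\<bar>f (M x)\<bar> \<noteq> \<infinity>" "\<bar>g (x - M x)\<bar> \<noteq> \<infinity>" for x
    using dom_U[of x] sub subdifferential_finite proper by (metis domD)+
  have h_eq: "h x = f (M x) + g (x - M x)" for x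
    unfolding h_def by (rule is_arg_min_inf_conv) (use M in blast)
  have sub_h: "u \<in> subdifferential h x" if "U x = Some u" for x u
    unfolding h_def
  proof (rule subdifferential_inf_conv)
    show "inf_conv f g x = f (M x) + g (x - M x)"
      using h_eq h_def by simp
    have "x \<in> dom U"
      using that by blast
    then show "u \<in> subdifferential f (M x)" "u \<in> subdifferential g (x - M x)"
      using sub that U_M' by metis+
  qed (rule fin)+
  have lev_h: "h x \<le> 0" if "x \<in> lev0 (f \<circ> M) \<inter> lev0 (g \<circ> (\<lambda>x. x - M x))" for x
    using that add_mono[of "f (M x)" 0 "g (x - M x)" 0] by (simp add: h_eq lev0_def)
  have "lev0 h \<noteq> {}"
    using lev_M lev_h by (auto simp: lev0_def)
  moreover have "is_selection (subdifferential h) U"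
    using sub_h by (auto simp: is_selection_def)
  moreover have "lev0 (f \<circ> M) \<inter> lev0 (g \<circ> (\<lambda>x. x - M x)) \<union> dom U
      \<subseteq> dom (subgrad_proj f U \<circ> M) \<inter> dom (subgrad_proj g U \<circ> (\<lambda>x. x - M x))
        \<inter> dom (subgrad_proj h U)"
  proof
    fix x
    assume "x \<in> lev0 (f \<circ> M) \<inter> lev0 (g \<circ> (\<lambda>x. x - M x)) \<union> dom U"
    then have "x \<in> dom (subgrad_proj h U)"
      using lev_h by (auto simp: dom_subgrad_proj lev0_def)
    moreover have "M x \<in> dom (subgrad_proj f U)" "x - M x \<in> dom (subgrad_proj g U)"
      using dom_U by (simp_all only: dom_subgrad_proj Un_iff simp_thms)
    ultimately show "x \<in> dom (subgrad_proj f U \<circ> M)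
        \<inter> dom (subgrad_proj g U \<circ> (\<lambda>x. x - M x)) \<inter> dom (subgrad_proj h U)"
      by (simp add: dom_def)
  qed
  moreover have "the (subgrad_proj h U x)
        = the (subgrad_proj f U (M x)) + the (subgrad_proj g U (x - M x))
      \<longleftrightarrow> f (M x) * g (x - M x) \<ge> 0"
    if x: "x \<in> lev0 (f \<circ> M) \<inter> lev0 (g \<circ> (\<lambda>x. x - M x)) \<union> dom U" for x
  proof -
    obtain a b where ab: "f (M x) = ereal a" "g (x - M x) = ereal b"
      using fin by (metis ereal_real')
    have h_ab: "h x = ereal (a + b)"
      by (simp add: h_eq ab)
    show ?thesis
    proof (cases "x \<in> dom U")
      \<comment> \<open>Here \<open>x\<close> lies in both level sets, so each projector fixes its
        argument: the equation reads \<open>x = M x + (x - M x)\<close>, and the product of two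
        nonpositive numbers is nonnegative. Both sides of the equivalence hold.\<close>
      case False
      then have "x \<in> lev0 (f \<circ> M) \<inter> lev0 (g \<circ> (\<lambda>x. x - M x))"
        using x by blast
      then have "a \<le> 0" "b \<le> 0"
        by (simp_all add: lev0_def ab)
      then show ?thesis
        by (simp add: subgrad_proj_def h_ab ab mult_nonpos_nonpos)
    next
      case True
      then obtain u where u: "U x = Some u"
        by blast
      then have uM: "U (M x) = Some u" "U (x - M x) = Some u"
        using U_M'[OF True] by simp_all
      \<comment> \<open>The base points cancel by \<open>x = M x + (x - M x)\<close>, leaving only
        multiples of the common \<open>u\<close>.\<close>
      have proj: "the (subgrad_proj h U x)
            = the (subgrad_proj f U (M x)) + the (subgrad_proj g U (x - M x))
          \<longleftrightarrow> (max (a + b) 0 / (norm u)\<^sup>2) *\<^sub>R u = ((max a 0 + max b 0) / (norm u)\<^sup>2) *\<^sub>R u"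
        by (auto simp: subgrad_proj_eq_max[where f = h and U = U, OF h_ab u]
            subgrad_proj_eq_max[where f = f and U = U, OF ab(1) uM(1)]
            subgrad_proj_eq_max[where f = g and U = U, OF ab(2) uM(2)] add_divide_distrib scaleR_add_left algebra_simps)
      show ?thesis
      proof (cases "u = 0")
        case True
        \<comment> \<open>With \<open>u = 0\<close> the equation in \<open>proj\<close> is trivially
          true, so the sign condition has to be true as well; it follows from both values being
          nonpositive.\<close>
        then have "f (M x) \<le> 0" "g (x - M x) \<le> 0"
          using sub(1)[OF uM(1)] sub(2)[OF uM(2)] lev_f lev_g
          by (simp_all add: zero_subgradient_nonpos)
        then show ?thesis
          using proj True by (simp add: ab mult_nonpos_nonpos)
      next
        case False
        \<comment> \<open>A nonzero \<open>u\<close> and its squared norm cancel, which leaves the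
          scalar identity of \<open>max_0_add_iff\<close>.\<close>
        then show ?thesis
          using proj by (simp add: ab max_0_add_iff)
      qed
    qed
  qed
  ultimately show ?thesis
    by (intro conjI ballI)
qed

end
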